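(* Let $\widetilde M(\phi,\xi,\eta,g)$ be a paracosymplectic manifold. Then there does not exist a proper warped product submanifold $M=B\times_f F$ of $\widetilde M$ with $\xi\in\Gamma(TF)$.
   Context: Almost paracontact manifold: a smooth $(2m+1)$-manifold $\widetilde M$ with a $(1,1)$-tensor field $\phi$, a vector field $\xi$ (the characteristic vector field) and a $1$-form $\eta$ such that $\phi^2=\mathrm{Id}-\eta\otimes\xi$, $\eta(\xi)=1$, and on the distribution $\ker\eta$ the eigendistributions of $\phi$ for the eigenvalues $+1$ and $-1$ both have dimension $m$. Almost paracontact metric manifold: in addition a pseudo-Riemannian metric $g$ (necessarily of signature $(m+1,m)$) with $g(X,Y)=-g(\phi X,\phi Y)+\eta(X)\eta(Y)$; then $\eta(X)=g(X,\xi)$. Put $\Phi(X,Y)=g(X,\phi Y)$. It is paracosymplectic if $\widetilde\nabla\eta=0$ and $\widetilde\nabla\Phi=0$, where $\widetilde\nabla$ is the Levi-Civita connection of $g$. Warped product: for pseudo-Riemannian manifolds $(B,g_B)$, $(F,g_F)$ and a positive smooth function $f$ on $B$, $B\times_f F$ is the product manifold $B\times F$ with the metric $g=g_B+f^2g_F$ (with $f$ pulled back to the product). It is trivial if $f$ is constant, and proper if $f$ is non-constant. A warped product submanifold of $\widetilde M$ is an isometrically immersed submanifold which, with the induced metric, is a warped product. $\Gamma(TB)$ and $\Gamma(TF)$ denote the vector fields on $B$ and $F$, regarded as vector fields on $M$ tangent to the respective factor via the natural lifts. *)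

theory Defs
  imports "HOL-Analysis.Analysis" "HOL-Library.Function_Algebras"
begin

text \<open>
  Tangent vectors are derivations, i.e. functionals on real functions, and vector fields are
  families of those. The pointwise real vector space structure on functions makes the library
  notion of dimension available for subspaces of tangent spaces.
\<close>

instantiation "fun" :: (type, real_vector) real_vector
begin

definition scaleR_fun :: "real \<Rightarrow> ('a \<Rightarrow> 'b) \<Rightarrow> 'a \<Rightarrow> 'b" where
  "scaleR_fun r f = (\<lambda>x. r *\<^sub>R f x)"

instance
  by standard (simp_all add: scaleR_fun_def fun_eq_iff scaleR_add_right scaleR_add_left)

end

definition linear_over :: "'a::real_vector set \<Rightarrow> ('a \<Rightarrow> 'b::real_vector) \<Rightarrow> bool" where
  "linear_over S L \<longleftrightarrow>
     (\<forall>u\<in>S. \<forall>v\<in>S. \<forall>a b. L (a *\<^sub>R u + b *\<^sub>R v) = a *\<^sub>R L u + b *\<^sub>R L v)"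


section \<open>Smooth manifolds\<close>

text \<open>Both notions are used for open sets only.\<close>

fun times_cont_diff_on :: "nat \<Rightarrow> ('a::euclidean_space \<Rightarrow> 'b::euclidean_space) \<Rightarrow> 'a set \<Rightarrow> bool" where
  "times_cont_diff_on 0 f S \<longleftrightarrow> continuous_on S f"
| "times_cont_diff_on (Suc k) f S \<longleftrightarrow>
     (\<forall>x\<in>S. f differentiable (at x)) \<and>
     (\<forall>v. times_cont_diff_on k (\<lambda>x. frechet_derivative f (at x) v) S)"

definition smooth_on :: "('a::euclidean_space \<Rightarrow> 'b::euclidean_space) \<Rightarrow> 'a set \<Rightarrow> bool" where
  "smooth_on f S \<longleftrightarrow> (\<forall>k. times_cont_diff_on k f S)"

text \<open>
  The underlying space of a manifold is a whole type (hence nonempty), Hausdorff and second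
  countable by its type classes. A chart is a domain together with a coordinate map (relevant
  only on the domain); the dimension of the manifold is that of the model space.
  The atlas need not be maximal.
\<close>

type_synonym ('a, 'e) chart = "'a set \<times> ('a \<Rightarrow> 'e)"
type_synonym ('a, 'e) atlas = "('a, 'e) chart set"

definition is_chart :: "('a::topological_space, 'e::euclidean_space) chart \<Rightarrow> bool" where
  "is_chart = (\<lambda>(U, \<psi>). open U \<and> open (\<psi> ` U) \<and> homeomorphism U (\<psi> ` U) \<psi> (inv_into U \<psi>))"

definition smooth_manifold ::
  "('a::{t2_space,second_countable_topology}, 'e::euclidean_space) atlas \<Rightarrow> bool" where
  "smooth_manifold A \<longleftrightarrow>
     (\<forall>c\<in>A. is_chart c) \<and> (\<Union>(U, \<psi>)\<in>A. U) = UNIV \<and>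
     (\<forall>(U, \<psi>)\<in>A. \<forall>(V, \<theta>)\<in>A. smooth_on (\<theta> \<circ> inv_into U \<psi>) (\<psi> ` (U \<inter> V)))"

definition smooth_functions :: "('a, 'e::euclidean_space) atlas \<Rightarrow> ('a \<Rightarrow> real) set" where
  "smooth_functions A = {f. \<forall>(U, \<psi>)\<in>A. smooth_on (f \<circ> inv_into U \<psi>) (\<psi> ` U)}"

definition smooth_map ::
  "('a::topological_space, 'e::euclidean_space) atlas \<Rightarrow>
   ('b::topological_space, 'd::euclidean_space) atlas \<Rightarrow> ('a \<Rightarrow> 'b) \<Rightarrow> bool" where
  "smooth_map A A' h \<longleftrightarrow> continuous_on UNIV h \<and>
     (\<forall>(U, \<psi>)\<in>A. \<forall>(V, \<theta>)\<in>A'. smooth_on (\<theta> \<circ> h \<circ> inv_into U \<psi>) (\<psi> ` (U \<inter> h -` V)))"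

definition product_atlas ::
  "('a, 'e) atlas \<Rightarrow> ('b, 'd) atlas \<Rightarrow> ('a \<times> 'b, 'e \<times> 'd) atlas" where
  "product_atlas A A' = {(U \<times> V, map_prod \<psi> \<theta>) | U \<psi> V \<theta>. (U, \<psi>) \<in> A \<and> (V, \<theta>) \<in> A'}"


section \<open>Tangent vectors and vector fields\<close>

type_synonym 'a tvec = "('a \<Rightarrow> real) \<Rightarrow> real"
type_synonym 'a vfield = "'a \<Rightarrow> 'a tvec"
type_synonym 'a metric_tensor = "'a \<Rightarrow> 'a tvec \<Rightarrow> 'a tvec \<Rightarrow> real"

text \<open>
  A tangent vector is a derivation of the algebra of smooth functions. The value 0 off that
  algebra is a convention that makes equality of tangent vectors the equality of functionals.
\<close>

definition tangent_space :: "('a, 'e::euclidean_space) atlas \<Rightarrow> 'a \<Rightarrow> 'a tvec set" where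
  "tangent_space A p =
     {v. linear_over (smooth_functions A) v \<and>
         (\<forall>f\<in>smooth_functions A. \<forall>h\<in>smooth_functions A. v (f * h) = v f * h p + f p * v h) \<and>
         (\<forall>f. f \<notin> smooth_functions A \<longrightarrow> v f = 0)}"

definition differential ::
  "('a, 'e::euclidean_space) atlas \<Rightarrow> ('b, 'd::euclidean_space) atlas \<Rightarrow> ('a \<Rightarrow> 'b) \<Rightarrow>
   'a tvec \<Rightarrow> 'b tvec" where
  "differential A A' h v = (\<lambda>f. if f \<in> smooth_functions A' then v (f \<circ> h) else 0)"

definition immersion ::
  "('a::topological_space, 'e::euclidean_space) atlas \<Rightarrow>
   ('b::topological_space, 'd::euclidean_space) atlas \<Rightarrow> ('a \<Rightarrow> 'b) \<Rightarrow> bool" where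
  "immersion A A' h \<longleftrightarrow>
     smooth_map A A' h \<and> (\<forall>p. inj_on (differential A A' h) (tangent_space A p))"

definition vector_fields :: "('a, 'e::euclidean_space) atlas \<Rightarrow> 'a vfield set" where
  "vector_fields A =
     {X. (\<forall>p. X p \<in> tangent_space A p) \<and>
         (\<forall>f\<in>smooth_functions A. (\<lambda>p. X p f) \<in> smooth_functions A)}"

definition lie_bracket :: "'a vfield \<Rightarrow> 'a vfield \<Rightarrow> 'a vfield" where
  "lie_bracket X Y = (\<lambda>p f. X p (\<lambda>q. Y q f) - Y p (\<lambda>q. X q f))"

definition one_form :: "('a, 'e::euclidean_space) atlas \<Rightarrow> ('a \<Rightarrow> 'a tvec \<Rightarrow> real) \<Rightarrow> bool" where
  "one_form A \<eta> \<longleftrightarrow>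
     (\<forall>p. linear_over (tangent_space A p) (\<eta> p)) \<and>
     (\<forall>X\<in>vector_fields A. (\<lambda>p. \<eta> p (X p)) \<in> smooth_functions A)"

definition endo_field :: "('a, 'e::euclidean_space) atlas \<Rightarrow> ('a \<Rightarrow> 'a tvec \<Rightarrow> 'a tvec) \<Rightarrow> bool" where
  "endo_field A \<phi> \<longleftrightarrow>
     (\<forall>p. linear_over (tangent_space A p) (\<phi> p) \<and>
          \<phi> p ` tangent_space A p \<subseteq> tangent_space A p) \<and>
     (\<forall>X\<in>vector_fields A. (\<lambda>p. \<phi> p (X p)) \<in> vector_fields A)"


section \<open>Pseudo-Riemannian metrics and the Levi-Civita connection\<close>

definition pseudo_riemannian_metric ::
  "('a, 'e::euclidean_space) atlas \<Rightarrow> 'a metric_tensor \<Rightarrow> bool" where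
  "pseudo_riemannian_metric A g \<longleftrightarrow>
     (\<forall>p. (\<forall>u\<in>tangent_space A p. linear_over (tangent_space A p) (g p u)) \<and>
          (\<forall>u\<in>tangent_space A p. \<forall>v\<in>tangent_space A p. g p u v = g p v u) \<and>
          (\<forall>u\<in>tangent_space A p. (\<forall>v\<in>tangent_space A p. g p u v = 0) \<longrightarrow> u = 0)) \<and>
     (\<forall>X\<in>vector_fields A. \<forall>Y\<in>vector_fields A. (\<lambda>p. g p (X p) (Y p)) \<in> smooth_functions A)"

definition pseudo_riemannian_manifold ::
  "('a::{t2_space,second_countable_topology}, 'e::euclidean_space) atlas \<Rightarrow>
   'a metric_tensor \<Rightarrow> bool" where
  "pseudo_riemannian_manifold A g \<longleftrightarrow> smooth_manifold A \<and> pseudo_riemannian_metric A g"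

type_synonym 'a connection = "'a vfield \<Rightarrow> 'a vfield \<Rightarrow> 'a vfield"

definition affine_connection :: "('a, 'e::euclidean_space) atlas \<Rightarrow> 'a connection \<Rightarrow> bool" where
  "affine_connection A D \<longleftrightarrow>
     (\<forall>X\<in>vector_fields A. \<forall>Y\<in>vector_fields A. D X Y \<in> vector_fields A) \<and>
     (\<forall>X\<in>vector_fields A. \<forall>Y\<in>vector_fields A. \<forall>Z\<in>vector_fields A.
        D (X + Y) Z = D X Z + D Y Z \<and> D X (Y + Z) = D X Y + D X Z) \<and>
     (\<forall>X\<in>vector_fields A. \<forall>Y\<in>vector_fields A. \<forall>f\<in>smooth_functions A.
        D (\<lambda>p. f p *\<^sub>R X p) Y = (\<lambda>p. f p *\<^sub>R D X Y p) \<and>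
        D X (\<lambda>p. f p *\<^sub>R Y p) = (\<lambda>p. X p f *\<^sub>R Y p + f p *\<^sub>R D X Y p))"

text \<open>A connection is determined by this on vector fields; its values elsewhere are immaterial.\<close>

definition levi_civita ::
  "('a, 'e::euclidean_space) atlas \<Rightarrow> 'a metric_tensor \<Rightarrow> 'a connection \<Rightarrow> bool" where
  "levi_civita A g D \<longleftrightarrow> affine_connection A D \<and>
     (\<forall>X\<in>vector_fields A. \<forall>Y\<in>vector_fields A. D X Y - D Y X = lie_bracket X Y) \<and>
     (\<forall>X\<in>vector_fields A. \<forall>Y\<in>vector_fields A. \<forall>Z\<in>vector_fields A. \<forall>p.
        X p (\<lambda>q. g q (Y q) (Z q)) = g p (D X Y p) (Z p) + g p (Y p) (D X Z p))"

definition parallel_1form ::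
  "('a, 'e::euclidean_space) atlas \<Rightarrow> 'a connection \<Rightarrow> ('a \<Rightarrow> 'a tvec \<Rightarrow> real) \<Rightarrow> bool" where
  "parallel_1form A D \<omega> \<longleftrightarrow>
     (\<forall>X\<in>vector_fields A. \<forall>Y\<in>vector_fields A. \<forall>p.
        X p (\<lambda>q. \<omega> q (Y q)) - \<omega> p (D X Y p) = 0)"

definition parallel_2tensor ::
  "('a, 'e::euclidean_space) atlas \<Rightarrow> 'a connection \<Rightarrow>
   ('a \<Rightarrow> 'a tvec \<Rightarrow> 'a tvec \<Rightarrow> real) \<Rightarrow> bool" where
  "parallel_2tensor A D \<omega> \<longleftrightarrow>
     (\<forall>X\<in>vector_fields A. \<forall>Y\<in>vector_fields A. \<forall>Z\<in>vector_fields A. \<forall>p.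
        X p (\<lambda>q. \<omega> q (Y q) (Z q)) - \<omega> p (D X Y p) (Z p) - \<omega> p (Y p) (D X Z p) = 0)"


section \<open>Almost paracontact metric and paracosymplectic manifolds\<close>

definition almost_paracontact_manifold ::
  "nat \<Rightarrow> ('a::{t2_space,second_countable_topology}, 'e::euclidean_space) atlas \<Rightarrow>
   ('a \<Rightarrow> 'a tvec \<Rightarrow> 'a tvec) \<Rightarrow> 'a vfield \<Rightarrow> ('a \<Rightarrow> 'a tvec \<Rightarrow> real) \<Rightarrow> bool" where
  "almost_paracontact_manifold m A \<phi> \<xi> \<eta> \<longleftrightarrow>
     smooth_manifold A \<and> DIM('e) = 2 * m + 1 \<and>
     endo_field A \<phi> \<and> \<xi> \<in> vector_fields A \<and> one_form A \<eta> \<and>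
     (\<forall>p. \<forall>v\<in>tangent_space A p. \<phi> p (\<phi> p v) = v - \<eta> p v *\<^sub>R \<xi> p) \<and>
     (\<forall>p. \<eta> p (\<xi> p) = 1) \<and>
     (\<forall>p. dim {v \<in> tangent_space A p. \<eta> p v = 0 \<and> \<phi> p v = v} = m \<and>
          dim {v \<in> tangent_space A p. \<eta> p v = 0 \<and> \<phi> p v = - v} = m)"

definition almost_paracontact_metric_manifold ::
  "nat \<Rightarrow> ('a::{t2_space,second_countable_topology}, 'e::euclidean_space) atlas \<Rightarrow>
   ('a \<Rightarrow> 'a tvec \<Rightarrow> 'a tvec) \<Rightarrow> 'a vfield \<Rightarrow> ('a \<Rightarrow> 'a tvec \<Rightarrow> real) \<Rightarrow>
   'a metric_tensor \<Rightarrow> bool" where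
  "almost_paracontact_metric_manifold m A \<phi> \<xi> \<eta> g \<longleftrightarrow>
     almost_paracontact_manifold m A \<phi> \<xi> \<eta> \<and> pseudo_riemannian_metric A g \<and>
     (\<forall>p. \<forall>u\<in>tangent_space A p. \<forall>v\<in>tangent_space A p.
        g p u v = - g p (\<phi> p u) (\<phi> p v) + \<eta> p u * \<eta> p v)"

definition fundamental_2form ::
  "('a \<Rightarrow> 'a tvec \<Rightarrow> 'a tvec) \<Rightarrow> 'a metric_tensor \<Rightarrow> 'a \<Rightarrow> 'a tvec \<Rightarrow> 'a tvec \<Rightarrow> real" where
  "fundamental_2form \<phi> g = (\<lambda>p u v. g p u (\<phi> p v))"

definition paracosymplectic_manifold ::
  "nat \<Rightarrow> ('a::{t2_space,second_countable_topology}, 'e::euclidean_space) atlas \<Rightarrow>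
   ('a \<Rightarrow> 'a tvec \<Rightarrow> 'a tvec) \<Rightarrow> 'a vfield \<Rightarrow> ('a \<Rightarrow> 'a tvec \<Rightarrow> real) \<Rightarrow>
   'a metric_tensor \<Rightarrow> bool" where
  "paracosymplectic_manifold m A \<phi> \<xi> \<eta> g \<longleftrightarrow>
     almost_paracontact_metric_manifold m A \<phi> \<xi> \<eta> g \<and>
     (\<exists>D. levi_civita A g D \<and> parallel_1form A D \<eta> \<and>
          parallel_2tensor A D (fundamental_2form \<phi> g))"


section \<open>Warped product submanifolds\<close>

definition warped_metric ::
  "('b, 'd::euclidean_space) atlas \<Rightarrow> 'b metric_tensor \<Rightarrow> ('b \<Rightarrow> real) \<Rightarrow>
   ('c, 'k::euclidean_space) atlas \<Rightarrow> 'c metric_tensor \<Rightarrow> ('b \<times> 'c) metric_tensor" where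
  "warped_metric AB gB f AF gF = (\<lambda>(p, q) u v.
     gB p (differential (product_atlas AB AF) AB fst u) (differential (product_atlas AB AF) AB fst v) +
     (f p)\<^sup>2 * gF q (differential (product_atlas AB AF) AF snd u)
                   (differential (product_atlas AB AF) AF snd v))"

text \<open>
  The map \<open>\<iota>\<close> immerses the warped product of \<open>(AB, gB)\<close> and \<open>(AF, gF)\<close> with warping
  function \<open>f\<close> isometrically into \<open>(A, g)\<close>.
\<close>

definition warped_product_submanifold ::
  "('a::{t2_space,second_countable_topology}, 'e::euclidean_space) atlas \<Rightarrow> 'a metric_tensor \<Rightarrow>
   ('b::{t2_space,second_countable_topology}, 'd::euclidean_space) atlas \<Rightarrow> 'b metric_tensor \<Rightarrow>
   ('b \<Rightarrow> real) \<Rightarrow>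
   ('c::{t2_space,second_countable_topology}, 'k::euclidean_space) atlas \<Rightarrow> 'c metric_tensor \<Rightarrow>
   ('b \<times> 'c \<Rightarrow> 'a) \<Rightarrow> bool" where
  "warped_product_submanifold A g AB gB f AF gF \<iota> \<longleftrightarrow>
     pseudo_riemannian_manifold AB gB \<and> pseudo_riemannian_manifold AF gF \<and>
     f \<in> smooth_functions AB \<and> (\<forall>p. f p > 0) \<and>
     immersion (product_atlas AB AF) A \<iota> \<and>
     (\<forall>x. \<forall>u\<in>tangent_space (product_atlas AB AF) x. \<forall>v\<in>tangent_space (product_atlas AB AF) x.
        g (\<iota> x) (differential (product_atlas AB AF) A \<iota> u) (differential (product_atlas AB AF) A \<iota> v) =
        warped_metric AB gB f AF gF x u v)"

definition proper_warped_product_submanifold ::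
  "('a::{t2_space,second_countable_topology}, 'e::euclidean_space) atlas \<Rightarrow> 'a metric_tensor \<Rightarrow>
   ('b::{t2_space,second_countable_topology}, 'd::euclidean_space) atlas \<Rightarrow> 'b metric_tensor \<Rightarrow>
   ('b \<Rightarrow> real) \<Rightarrow>
   ('c::{t2_space,second_countable_topology}, 'k::euclidean_space) atlas \<Rightarrow> 'c metric_tensor \<Rightarrow>
   ('b \<times> 'c \<Rightarrow> 'a) \<Rightarrow> bool" where
  "proper_warped_product_submanifold A g AB gB f AF gF \<iota> \<longleftrightarrow>
     warped_product_submanifold A g AB gB f AF gF \<iota> \<and> \<not> f constant_on UNIV"

text \<open>
  The natural lift to the product of a vector field on the second factor: at \<open>(p, q)\<close> it is
  the image of the vector at \<open>q\<close> under the inclusion of the fibre over \<open>p\<close>.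
\<close>

definition fibre_lift ::
  "('b, 'd::euclidean_space) atlas \<Rightarrow> ('c, 'k::euclidean_space) atlas \<Rightarrow>
   'c vfield \<Rightarrow> ('b \<times> 'c) vfield" where
  "fibre_lift AB AF W = (\<lambda>(p, q). differential AF (product_atlas AB AF) (Pair p) (W q))"

text \<open>
  The vector field \<open>Z\<close> of the ambient manifold lies, along the immersion \<open>\<iota>\<close>, in the set of
  vector fields on the second factor (regarded as vector fields on the product by lifting).
\<close>

definition in_Gamma_TF ::
  "('a, 'e::euclidean_space) atlas \<Rightarrow> ('b, 'd::euclidean_space) atlas \<Rightarrow>
   ('c, 'k::euclidean_space) atlas \<Rightarrow> ('b \<times> 'c \<Rightarrow> 'a) \<Rightarrow> 'a vfield \<Rightarrow> bool" where
  "in_Gamma_TF A AB AF \<iota> Z \<longleftrightarrow>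
     (\<exists>W\<in>vector_fields AF. \<forall>x.
        Z (\<iota> x) = differential (product_atlas AB AF) A \<iota> (fibre_lift AB AF W x))"

end

theory Submission
  imports Defs
begin

text \<open>
  The axioms of an almost paracontact metric structure force \<open>\<phi> \<xi> = 0\<close>, hence \<open>g(\<xi>, \<xi>) = 1\<close>.
  If \<open>\<xi>\<close> is along the immersion the lift of a vector field \<open>W\<close> of the fibre, then the isometry
  condition at \<open>(p, q)\<close> reads \<open>f(p)\<^sup>2 g\<^sub>F(W q, W q) = 1\<close>. For fixed \<open>q\<close> this determines the
  positive number \<open>f p\<close>, so \<open>f\<close> is constant.
\<close>

section \<open>Closure properties of smooth functions\<close>

lemma times_cont_diff_on_cong:
  assumes "open S" "times_cont_diff_on k f S" "\<And>x. x \<in> S \<Longrightarrow> f x = h x"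
  shows "times_cont_diff_on k h S"
  using assms(2,3)
proof (induction k arbitrary: f h)
  case 0
  then show ?case by (simp cong: continuous_on_cong)
next
  case (Suc k)
  have der: "(h has_derivative frechet_derivative f (at x)) (at x)" if "x \<in> S" for x
  proof (rule has_derivative_transform_within_open)
    show "(f has_derivative frechet_derivative f (at x)) (at x)"
      using Suc.prems(1) that by (simp add: frechet_derivative_works)
  qed (use assms(1) Suc.prems(2) that in auto)
  have "times_cont_diff_on k (\<lambda>x. frechet_derivative h (at x) v) S" for v
  proof (rule Suc.IH)
    show "times_cont_diff_on k (\<lambda>x. frechet_derivative f (at x) v) S"
      using Suc.prems(1) by simp
  qed (use der frechet_derivative_at in metis)
  then show ?case
    using der by (auto simp: differentiable_def)
qed

text \<open>Derivatives are unique at points of an open set, so any explicit formula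
  \<open>f'\<close> may replace \<open>frechet_derivative\<close>. This is the introduction rule for
  the inductive steps below.\<close>

lemma times_cont_diff_on_Suc:
  assumes "open S" "\<And>x. x \<in> S \<Longrightarrow> (f has_derivative f' x) (at x)"
    "\<And>v. times_cont_diff_on k (\<lambda>x. f' x v) S"
  shows "times_cont_diff_on (Suc k) f S"
proof -
  have "times_cont_diff_on k (\<lambda>x. frechet_derivative f (at x) v) S" for v
    by (rule times_cont_diff_on_cong[OF assms(1) assms(3)[of v]])
      (use assms(2) frechet_derivative_at in metis)
  then show ?thesis
    using assms(2) by (auto simp: differentiable_def)
qed

lemma times_cont_diff_on_SucD:
  "times_cont_diff_on (Suc k) f S \<Longrightarrow> times_cont_diff_on k f S"
proof (induction k arbitrary: f)
  case 0
  then show ?case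
    by (auto intro!: continuous_at_imp_continuous_on differentiable_imp_continuous_within)
next
  case (Suc k)
  then show ?case by (metis times_cont_diff_on.simps(2))
qed

lemma times_cont_diff_on_linear_combination:
  assumes "open S" "times_cont_diff_on k f S" "times_cont_diff_on k h S"
  shows "times_cont_diff_on k (\<lambda>x. a *\<^sub>R f x + b *\<^sub>R h x) S"
  using assms(2,3)
proof (induction k arbitrary: f h)
  case 0
  then show ?case by (auto intro!: continuous_intros)
next
  case (Suc k)
  show ?case
  proof (rule times_cont_diff_on_Suc[OF assms(1)])
    show "((\<lambda>x. a *\<^sub>R f x + b *\<^sub>R h x) has_derivative
        (\<lambda>v. a *\<^sub>R frechet_derivative f (at x) v + b *\<^sub>R frechet_derivative h (at x) v)) (at x)"
      if "x \<in> S" for x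
      using Suc.prems that
      by (auto intro!: derivative_intros simp: frechet_derivative_works)
  qed (use Suc in auto)
qed

text \<open>By the Leibniz rule the derivative is a sum of products of one derivative and one
  undifferentiated factor. Lowering the order of the latter with
  \<open>times_cont_diff_on_SucD\<close> makes the induction hypothesis apply.\<close>

lemma times_cont_diff_on_mult:
  fixes f h :: "'a::euclidean_space \<Rightarrow> real"
  assumes "open S" "times_cont_diff_on k f S" "times_cont_diff_on k h S"
  shows "times_cont_diff_on k (\<lambda>x. f x * h x) S"
  using assms(2,3)
proof (induction k arbitrary: f h)
  case 0
  then show ?case by (auto intro!: continuous_intros)
next
  case (Suc k)
  show ?case
  proof (rule times_cont_diff_on_Suc[OF assms(1)])
    show "((\<lambda>x. f x * h x) has_derivative
        (\<lambda>v. f x * frechet_derivative h (at x) v + frechet_derivative f (at x) v * h x)) (at x)"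
      if "x \<in> S" for x
      using Suc.prems that
      by (auto intro!: has_derivative_mult simp: frechet_derivative_works)
    show "times_cont_diff_on k
        (\<lambda>x. f x * frechet_derivative h (at x) v + frechet_derivative f (at x) v * h x) S" for v
      using times_cont_diff_on_linear_combination[OF assms(1),
          of k "\<lambda>x. f x * frechet_derivative h (at x) v"
            "\<lambda>x. frechet_derivative f (at x) v * h x" 1 1]
        Suc times_cont_diff_on_SucD[OF Suc.prems(1)] times_cont_diff_on_SucD[OF Suc.prems(2)]
      by simp
  qed
qed

text \<open>The slice map \<open>Pair a\<close> is affine with derivative \<open>Pair 0\<close>.
  Hence the derivative of the restriction in direction \<open>v\<close> is the restriction to the
  slice of the derivative of \<open>f\<close> in direction \<open>(0, v)\<close>, and the induction
  runs over all \<open>f\<close>.\<close>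

lemma times_cont_diff_on_Pair:
  assumes "open T" "open S" "Pair a ` T \<subseteq> S" "times_cont_diff_on k f S"
  shows "times_cont_diff_on k (f \<circ> Pair a) T"
  using assms(4)
proof (induction k arbitrary: f)
  case 0
  have "continuous_on T (Pair a)"
    by (intro continuous_intros)
  moreover have "continuous_on (Pair a ` T) f"
    using 0 assms(3) continuous_on_subset by auto
  ultimately show ?case
    by (simp only: times_cont_diff_on.simps continuous_on_compose)
next
  case (Suc k)
  show ?case
  proof (rule times_cont_diff_on_Suc[OF assms(1)])
    show "(f \<circ> Pair a has_derivative (\<lambda>v. frechet_derivative f (at (a, y)) (0, v))) (at y)"
      if "y \<in> T" for y
    proof -
      have "(f has_derivative frechet_derivative f (at (a, y))) (at (a, y))"
        using Suc.prems assms(3) that by (auto simp: frechet_derivative_works)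
      moreover have "(Pair a has_derivative Pair 0) (at y)"
        by (auto intro!: derivative_eq_intros)
      ultimately show ?thesis
        using diff_chain_at[of "Pair a" "Pair 0" y f] by (simp add: o_def)
    qed
    show "times_cont_diff_on k (\<lambda>y. frechet_derivative f (at (a, y)) (0, v)) T" for v
      using Suc.IH[of "\<lambda>x. frechet_derivative f (at x) (0, v)"] Suc.prems
      by (simp add: o_def)
  qed
qed

lemma smooth_on_cong:
  "open S \<Longrightarrow> smooth_on f S \<Longrightarrow> (\<And>x. x \<in> S \<Longrightarrow> f x = h x) \<Longrightarrow> smooth_on h S"
  unfolding smooth_on_def using times_cont_diff_on_cong by blast

lemma smooth_on_Pair:
  "open T \<Longrightarrow> open S \<Longrightarrow> Pair a ` T \<subseteq> S \<Longrightarrow> smooth_on f S \<Longrightarrow> smooth_on (f \<circ> Pair a) T"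
  unfolding smooth_on_def using times_cont_diff_on_Pair by blast

lemma smooth_on_linear_combination:
  "open S \<Longrightarrow> smooth_on f S \<Longrightarrow> smooth_on h S \<Longrightarrow> smooth_on (\<lambda>x. a *\<^sub>R f x + b *\<^sub>R h x) S"
  unfolding smooth_on_def using times_cont_diff_on_linear_combination by blast

lemma smooth_on_mult:
  fixes f h :: "'a::euclidean_space \<Rightarrow> real"
  shows "open S \<Longrightarrow> smooth_on f S \<Longrightarrow> smooth_on h S \<Longrightarrow> smooth_on (\<lambda>x. f x * h x) S"
  unfolding smooth_on_def using times_cont_diff_on_mult by blast

section \<open>Smooth functions on manifolds and their restriction to fibres\<close>

lemma smooth_functionsD:
  "f \<in> smooth_functions A \<Longrightarrow> (U, \<psi>) \<in> A \<Longrightarrow> smooth_on (f \<circ> inv_into U \<psi>) (\<psi> ` U)"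
  unfolding smooth_functions_def by blast

text \<open>The atlas is only required to have open chart images, so the rule applies directly to a
  product atlas.\<close>

lemma smooth_functions_linear_combination:
  fixes A :: "('a, 'e::euclidean_space) atlas"
  assumes "\<And>U \<psi>. (U, \<psi>) \<in> A \<Longrightarrow> open (\<psi> ` U)"
    "f \<in> smooth_functions A" "h \<in> smooth_functions A"
  shows "a *\<^sub>R f + b *\<^sub>R h \<in> smooth_functions A"
proof -
  have "(a *\<^sub>R f + b *\<^sub>R h) \<circ> k = (\<lambda>x. a *\<^sub>R (f \<circ> k) x + b *\<^sub>R (h \<circ> k) x)" for k :: "'e \<Rightarrow> 'a"
    by (simp add: fun_eq_iff scaleR_fun_def)
  moreover have "smooth_on (\<lambda>x. a *\<^sub>R (f \<circ> inv_into U \<psi>) x + b *\<^sub>R (h \<circ> inv_into U \<psi>) x) (\<psi> ` U)"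
    if "(U, \<psi>) \<in> A" for U \<psi>
  proof (rule smooth_on_linear_combination)
    show "open (\<psi> ` U)"
      using assms(1) that .
  qed (use assms(2,3) that smooth_functionsD in blast)+
  ultimately show ?thesis
    by (auto simp: smooth_functions_def)
qed

lemma smooth_functions_mult:
  fixes A :: "('a, 'e::euclidean_space) atlas"
  assumes "\<And>U \<psi>. (U, \<psi>) \<in> A \<Longrightarrow> open (\<psi> ` U)"
    "f \<in> smooth_functions A" "h \<in> smooth_functions A"
  shows "f * h \<in> smooth_functions A"
proof -
  have "(f * h) \<circ> k = (\<lambda>x. (f \<circ> k) x * (h \<circ> k) x)" for k :: "'e \<Rightarrow> 'a"
    by (simp add: fun_eq_iff)
  moreover have "smooth_on (\<lambda>x. (f \<circ> inv_into U \<psi>) x * (h \<circ> inv_into U \<psi>) x) (\<psi> ` U)"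
    if "(U, \<psi>) \<in> A" for U \<psi>
  proof (rule smooth_on_mult)
    show "open (\<psi> ` U)"
      using assms(1) that .
  qed (use assms(2,3) that smooth_functionsD in blast)+
  ultimately show ?thesis
    by (auto simp: smooth_functions_def)
qed

lemma smooth_manifold_chartD:
  assumes "smooth_manifold A" "(U, \<psi>) \<in> A"
  shows "open (\<psi> ` U)" "inj_on \<psi> U"
proof -
  have "is_chart (U, \<psi>)"
    using assms unfolding smooth_manifold_def by blast
  then show "open (\<psi> ` U)" "inj_on \<psi> U"
    unfolding is_chart_def by (auto simp: homeomorphism_def intro: inj_on_inverseI)
qed

lemma product_atlas_open_image:
  assumes "smooth_manifold AB" "smooth_manifold AF" "(U, \<psi>) \<in> product_atlas AB AF"
  shows "open (\<psi> ` U)"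
proof -
  obtain V \<theta> V' \<theta>' where "U = V \<times> V'" "\<psi> = map_prod \<theta> \<theta>'" "(V, \<theta>) \<in> AB" "(V', \<theta>') \<in> AF"
    using assms(3) by (auto simp: product_atlas_def)
  then show ?thesis
    using open_Times[OF smooth_manifold_chartD(1)[OF assms(1)] smooth_manifold_chartD(1)[OF assms(2)]]
    by (simp add: map_prod_surj_on[OF refl refl])
qed

text \<open>In a product chart built from one fixed chart around \<open>p\<close>, the fibre over
  \<open>p\<close> becomes a slice with constant first coordinate \<open>\<psi> p\<close>, so
  \<open>smooth_on_Pair\<close> applies.\<close>

lemma smooth_functions_Pair:
  assumes AB: "smooth_manifold AB" and AF: "smooth_manifold AF"
    and h: "h \<in> smooth_functions (product_atlas AB AF)"
  shows "h \<circ> Pair p \<in> smooth_functions AF"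
proof -
  obtain U \<psi> where U: "(U, \<psi>) \<in> AB" "p \<in> U"
    using AB unfolding smooth_manifold_def by blast
  have "smooth_on ((h \<circ> Pair p) \<circ> inv_into V \<theta>) (\<theta> ` V)" if V: "(V, \<theta>) \<in> AF" for V \<theta>
  proof -
    let ?k = "inv_into (U \<times> V) (map_prod \<psi> \<theta>)"
    note charts = smooth_manifold_chartD[OF AB U(1)] smooth_manifold_chartD[OF AF V]
    have "(U \<times> V, map_prod \<psi> \<theta>) \<in> product_atlas AB AF"
      using U V by (auto simp: product_atlas_def)
    then have "smooth_on (h \<circ> ?k) (\<psi> ` U \<times> \<theta> ` V)"
      using smooth_functionsD[OF h] by (metis map_prod_surj_on)
    then have "smooth_on ((h \<circ> ?k) \<circ> Pair (\<psi> p)) (\<theta> ` V)"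
      using U charts by (intro smooth_on_Pair[of _ "\<psi> ` U \<times> \<theta> ` V"]) (auto intro: open_Times)
    moreover have "?k (\<psi> p, \<theta> q) = (p, q)" if "q \<in> V" for q
      using inv_into_f_f[OF map_prod_inj_on[OF charts(2,4)], of "(p, q)"] U that by simp
    ultimately show ?thesis
      using charts by (auto elim!: smooth_on_cong[rotated])
  qed
  then show ?thesis
    by (auto simp: smooth_functions_def)
qed

section \<open>Fibre lifts\<close>

lemma linear_over_scaleR:
  assumes "linear_over S L" "u \<in> S"
  shows "L (c *\<^sub>R u) = c *\<^sub>R L u"
proof -
  have "L (c *\<^sub>R u + 0 *\<^sub>R u) = c *\<^sub>R L u + 0 *\<^sub>R L u"
    using assms by (simp add: linear_over_def del: scaleR_zero_left)
  then show ?thesis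
    by simp
qed

lemma tangent_space_zero: "0 \<in> tangent_space A p"
  by (simp add: tangent_space_def linear_over_def)

text \<open>For \<open>c \<noteq> 0\<close>, the square of the constant \<open>c\<close> is also its
  multiple by \<open>c\<close>; the Leibniz rule and linearity then give
  \<open>c * v c = 2 * (c * v c)\<close>. For \<open>c = 0\<close> linearity suffices. Outside the
  algebra of smooth functions the value is 0 by convention.\<close>

lemma tangent_space_const:
  assumes v: "v \<in> tangent_space A p"
  shows "v (\<lambda>_. c) = 0"
proof (cases "(\<lambda>_. c) \<in> smooth_functions A")
  case True
  let ?c = "\<lambda>_::'a. c"
  have lin: "v (a *\<^sub>R ?c + b *\<^sub>R ?c) = a * v ?c + b * v ?c" for a b
    using v True by (simp add: tangent_space_def linear_over_def)
  have "c *\<^sub>R ?c + 0 *\<^sub>R ?c = ?c * ?c"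
    by (simp add: fun_eq_iff scaleR_fun_def)
  then have "c * v ?c = 2 * (c * v ?c)"
    using lin[of c 0] v True by (simp add: tangent_space_def)
  moreover have "v ?c = 0" if "c = 0"
  proof -
    have "0 *\<^sub>R ?c + 0 *\<^sub>R ?c = ?c"
      using that by (simp add: fun_eq_iff scaleR_fun_def)
    then show ?thesis
      using lin[of 0 0] by simp
  qed
  ultimately show ?thesis
    by auto
qed (use v in \<open>simp add: tangent_space_def\<close>)

text \<open>Composition with \<open>Pair p\<close> is an algebra homomorphism from smooth functions
  on the product to smooth functions on the fibre, so it turns a derivation at \<open>q\<close> into
  one at \<open>(p, q)\<close>.\<close>

lemma fibre_lift_tangent:
  assumes AB: "smooth_manifold AB" and AF: "smooth_manifold AF"
    and W: "W \<in> vector_fields AF"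
  shows "fibre_lift AB AF W (p, q) \<in> tangent_space (product_atlas AB AF) (p, q)"
proof -
  let ?P = "product_atlas AB AF"
  have Wq: "W q \<in> tangent_space AF q"
    using W by (simp add: vector_fields_def)
  note smooth = smooth_functions_Pair[OF AB AF]
    smooth_functions_linear_combination[OF product_atlas_open_image[OF AB AF]]
    smooth_functions_mult[OF product_atlas_open_image[OF AB AF]]
  have add: "(a *\<^sub>R f + b *\<^sub>R h) \<circ> Pair p = a *\<^sub>R (f \<circ> Pair p) + b *\<^sub>R (h \<circ> Pair p)"
    for a b and f h :: "'a \<times> 'c \<Rightarrow> real"
    by (simp add: fun_eq_iff scaleR_fun_def)
  have mult: "(f * h) \<circ> Pair p = (f \<circ> Pair p) * (h \<circ> Pair p)" for f h :: "'a \<times> 'c \<Rightarrow> real"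
    by (simp add: fun_eq_iff)
  show ?thesis
    using Wq
    by (simp add: fibre_lift_def differential_def tangent_space_def linear_over_def
        smooth add mult)
qed

text \<open>The map \<open>fst \<circ> Pair p\<close> is constant, so \<open>W q\<close> is only
  evaluated on constant functions.\<close>

lemma differential_fst_fibre_lift:
  assumes "W \<in> vector_fields AF"
  shows "differential (product_atlas AB AF) AB fst (fibre_lift AB AF W (p, q)) = 0"
proof -
  have "W q \<in> tangent_space AF q"
    using assms by (simp add: vector_fields_def)
  then show ?thesis
    by (simp add: fibre_lift_def differential_def fun_eq_iff o_def tangent_space_const)
qed

text \<open>Since \<open>snd \<circ> Pair p\<close> is the identity for every \<open>p\<close>, the
  base point drops out; the membership test for \<open>f \<circ> snd\<close> in
  \<open>differential\<close> is the same on both sides.\<close>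

lemma differential_snd_fibre_lift:
  "differential (product_atlas AB AF) AF snd (fibre_lift AB AF W (p, q)) =
   differential (product_atlas AB AF) AF snd (fibre_lift AB AF W (p', q))"
  by (simp add: fibre_lift_def differential_def fun_eq_iff o_def)

section \<open>Non-existence of proper warped products\<close>

lemma metric_zero:
  assumes "pseudo_riemannian_metric A g"
  shows "g p 0 0 = 0"
proof -
  have "\<forall>u\<in>tangent_space A p. linear_over (tangent_space A p) (g p u)"
    using assms by (simp add: pseudo_riemannian_metric_def)
  then have "linear_over (tangent_space A p) (g p 0)"
    using tangent_space_zero by (rule bspec)
  from linear_over_scaleR[OF this tangent_space_zero, of 0] show ?thesis
    by simp
qed

text \<open>Once \<phi> \<xi> = 0, compatibility of the metric at (\<xi>, \<xi>) leaves only the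
  square of \<eta>(\<xi>) = 1. The vanishing comes from applying the formula for the square of
  \<phi> first to \<xi> and then to \<phi> \<xi>.\<close>

lemma characteristic_unit:
  assumes "almost_paracontact_metric_manifold m A \<phi> \<xi> \<eta> g"
  shows "g p (\<xi> p) (\<xi> p) = 1"
proof -
  let ?x = "\<xi> p" and ?w = "\<phi> p (\<xi> p)"
  have AP: "almost_paracontact_manifold m A \<phi> \<xi> \<eta>"
    using assms by (simp add: almost_paracontact_metric_manifold_def)
  have x: "?x \<in> tangent_space A p" and eta: "\<eta> p ?x = 1"
    and lin: "linear_over (tangent_space A p) (\<phi> p)"
    using AP by (auto simp: almost_paracontact_manifold_def vector_fields_def endo_field_def)
  have w: "?w \<in> tangent_space A p"
    using AP x by (fastforce simp: almost_paracontact_manifold_def endo_field_def)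
  have sq: "\<phi> p (\<phi> p v) = v - \<eta> p v *\<^sub>R ?x" if "v \<in> tangent_space A p" for v
    using AP that by (simp add: almost_paracontact_manifold_def)
  have scale: "\<phi> p (c *\<^sub>R ?x) = c *\<^sub>R ?w" for c
    using lin x by (rule linear_over_scaleR)
  have w0: "\<phi> p ?w = 0"
    using sq[OF x] eta by simp
  have z: "\<phi> p 0 = 0"
    using scale[of 0] by simp
  have wx: "?w = \<eta> p ?w *\<^sub>R ?x"
    using sq[OF w] w0 z by simp
  have "\<phi> p ?w = \<eta> p ?w *\<^sub>R ?w"
    using scale[of "\<eta> p ?w"] wx by simp
  \<comment> \<open>Both expressions for \<open>\<phi> p ?w\<close> give
    \<open>\<eta> p ?w *\<^sub>R ?w = 0\<close>. If the scalar vanishes, \<open>wx\<close> still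
    forces \<open>?w = 0\<close>.\<close>
  then have w_zero: "?w = 0"
    using w0 wx by auto
  have "g p ?x ?x = - g p ?w ?w + \<eta> p ?x * \<eta> p ?x"
    using assms x unfolding almost_paracontact_metric_manifold_def by blast
  moreover have "g p 0 0 = 0"
    using assms metric_zero by (auto simp: almost_paracontact_metric_manifold_def)
  ultimately show ?thesis
    using eta w_zero by simp
qed

theorem corollary3p4:
  fixes m :: nat
    and A :: "('a::{t2_space,second_countable_topology}, 'e::euclidean_space) atlas"
    and \<phi> :: "'a \<Rightarrow> 'a tvec \<Rightarrow> 'a tvec"
    and \<xi> :: "'a vfield"
    and \<eta> :: "'a \<Rightarrow> 'a tvec \<Rightarrow> real"
    and g :: "'a metric_tensor"
  assumes "paracosymplectic_manifold m A \<phi> \<xi> \<eta> g"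
  shows "\<not> (\<exists>(AB :: ('b::{t2_space,second_countable_topology}, 'd::euclidean_space) atlas) gB f
              (AF :: ('c::{t2_space,second_countable_topology}, 'k::euclidean_space) atlas) gF \<iota>.
            proper_warped_product_submanifold A g AB gB f AF gF \<iota> \<and> in_Gamma_TF A AB AF \<iota> \<xi>)"
proof (intro notI, elim exE conjE)
  fix AB :: "('b, 'd) atlas" and gB f and AF :: "('c, 'k) atlas" and gF \<iota>
  assume proper: "proper_warped_product_submanifold A g AB gB f AF gF \<iota>"
    and "in_Gamma_TF A AB AF \<iota> \<xi>"
  then obtain W where W: "W \<in> vector_fields AF"
    and \<xi>: "\<And>x. \<xi> (\<iota> x) = differential (product_atlas AB AF) A \<iota> (fibre_lift AB AF W x)"
    unfolding in_Gamma_TF_def by blast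
  have wp: "warped_product_submanifold A g AB gB f AF gF \<iota>" and nonconst: "\<not> f constant_on UNIV"
    using proper by (auto simp: proper_warped_product_submanifold_def)
  have pos: "f p > 0" for p
    using wp by (simp add: warped_product_submanifold_def)
  have AB: "smooth_manifold AB" "pseudo_riemannian_metric AB gB" and AF: "smooth_manifold AF"
    using wp by (auto simp: warped_product_submanifold_def pseudo_riemannian_manifold_def)
  \<comment> \<open>One fibre point suffices, and it exists because types are inhabited.\<close>
  fix q :: 'c
  define z where "z = (\<lambda>p. differential (product_atlas AB AF) AF snd (fibre_lift AB AF W (p, q)))"
  have unit: "(f p)\<^sup>2 * gF q (z p) (z p) = 1" for p
  proof -
    let ?l = "fibre_lift AB AF W (p, q)"
    have "1 = g (\<iota> (p, q)) (\<xi> (\<iota> (p, q))) (\<xi> (\<iota> (p, q)))"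
      using assms characteristic_unit by (metis paracosymplectic_manifold_def)
    also have "\<dots> = warped_metric AB gB f AF gF (p, q) ?l ?l"
      using wp fibre_lift_tangent[OF AB(1) AF W] unfolding \<xi> warped_product_submanifold_def by blast
    also have "\<dots> = (f p)\<^sup>2 * gF q (z p) (z p)"
      by (simp add: warped_metric_def differential_fst_fibre_lift[OF W] metric_zero[OF AB(2)] z_def)
    finally show ?thesis by simp
  qed
  have "f p = f p'" for p p'
  proof -
    have "z p = z p'"
      unfolding z_def by (rule differential_snd_fibre_lift)
    \<comment> \<open>The common factor \<open>gF q (z p) (z p)\<close> can be cancelled: it is
      nonzero because its product with the square of \<open>f p\<close> is 1. Positivity of
      \<open>f\<close> then removes the sign ambiguity.\<close>
    then have "(f p)\<^sup>2 = (f p')\<^sup>2"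
      using unit[of p] unit[of p'] by (metis mult_cancel_right mult_zero_right zero_neq_one)
    then show ?thesis
      using pos by (simp add: less_imp_le power2_eq_iff_nonneg)
  qed
  then show False
    using nonconst unfolding constant_on_def by blast
qed

end
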